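(* Let $R$ be a unital ring with involution and let $a,x\in R$. The following statements are equivalent: (i) $a$ is group invertible and $x=a^\#$. (ii) $axa=a$, $xR=aR$ and $Rx=Ra$. (iii) $axa=a$, ${}^\circ x={}^\circ a$ and $x^\circ=a^\circ$. (iv) $axa=a$, $xR\subseteq aR$ and $Rx\subseteq Ra$. (v) $axa=a$, ${}^\circ a\subseteq{}^\circ x$ and $a^\circ\subseteq x^\circ$.
   Context: For $a\in R$: $aR=\{ax:x\in R\}$, $Ra=\{xa:x\in R\}$, $a^\circ=\{x\in R: ax=0\}$, ${}^\circ a=\{x\in R: xa=0\}$. The element $a$ is group invertible if there is $y\in R$ with $aya=a$, $yay=y$, $ay=ya$; such $y$ is unique and is denoted $a^\#$. *)

theory Defs
  imports Main
begin

(* The class ring_1 assumes 0 \<noteq> 1; combining ring with monoid_mult also admits the zero ring.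
   An involution is an additive anti-automorphism of order dividing two. *)
class involutive_ring = ring + monoid_mult +
  fixes star :: "'a \<Rightarrow> 'a"
  assumes star_star: "star (star x) = x"
    and star_add: "star (x + y) = star x + star y"
    and star_mult: "star (x * y) = star y * star x"

definition right_princ :: "'a::{ring, monoid_mult} \<Rightarrow> 'a set"  (* aR *)
  where "right_princ a = {a * x | x. x \<in> UNIV}"

definition left_princ :: "'a::{ring, monoid_mult} \<Rightarrow> 'a set"  (* Ra *)
  where "left_princ a = {x * a | x. x \<in> UNIV}"

(* The superscript circle written after a: elements killed by left multiplication with a. *)
definition right_ann :: "'a::{ring, monoid_mult} \<Rightarrow> 'a set"
  where "right_ann a = {x. a * x = 0}"

(* The superscript circle written before a. *)
definition left_ann :: "'a::{ring, monoid_mult} \<Rightarrow> 'a set"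
  where "left_ann a = {x. x * a = 0}"

definition is_group_inverse :: "'a::{ring, monoid_mult} \<Rightarrow> 'a \<Rightarrow> bool"
  where "is_group_inverse a y \<longleftrightarrow> a * y * a = a \<and> y * a * y = y \<and> a * y = y * a"

definition group_invertible :: "'a::{ring, monoid_mult} \<Rightarrow> bool"
  where "group_invertible a \<longleftrightarrow> (\<exists>y. is_group_inverse a y)"

(* Meaningful only if a is group invertible. *)
definition group_inverse :: "'a::{ring, monoid_mult} \<Rightarrow> 'a"
  where "group_inverse a = (THE y. is_group_inverse a y)"

lemma is_group_inverse_unique:
  fixes a y z :: "'a::{ring, monoid_mult}"
  assumes "is_group_inverse a y" and "is_group_inverse a z"
  shows "y = z"
proof -
  have y: "a * y * a = a" "y * a * y = y" "a * y = y * a"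
    and z: "a * z * a = a" "z * a * z = z" "a * z = z * a"
    using assms by (auto simp: is_group_inverse_def)
  have "a * y = (a * z) * (a * y)" using z(1) by (simp add: mult.assoc [symmetric])
  also have "\<dots> = z * (a * y * a)" by (simp only: y(3) [symmetric] z(3) mult.assoc)
  also have "\<dots> = a * z" by (simp only: y(1) z(3))
  finally have e: "a * y = a * z" .
  have "y = y * (a * y)" using y(2) by (simp add: mult.assoc)
  also have "\<dots> = y * a * z" by (simp only: e mult.assoc)
  also have "\<dots> = z * a * z" using e y(3) z(3) by metis
  also have "\<dots> = z" by (fact z(2))
  finally show ?thesis .
qed

lemma group_inverse_eqI: "is_group_inverse a y \<Longrightarrow> group_inverse a = y"
  unfolding group_inverse_def by (blast intro: the_equality is_group_inverse_unique)

end

(* Since axa = a, the element 1 - ax annihilates a from the left and 1 - xa annihilates it from the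
   right. The annihilator inclusions transfer this to x, giving x = ax^2 and x = x^2a; multiplying the
   first by a from the right and the second by a from the left gives xa = ax^2a = ax. *)

theory Submission
  imports Defs
begin

text \<open>The unit puts \<open>x\<close> itself into its principal right ideal, so
  \<open>x = a * u\<close> for some \<open>u\<close>, and whatever kills \<open>a\<close> from the
  left kills \<open>a * u\<close>. Inclusions are thus reversed in passing to annihilators.\<close>

lemma left_ann_mono:
  fixes a x :: "'a::{ring, monoid_mult}"
  assumes "right_princ x \<subseteq> right_princ a"
  shows "left_ann a \<subseteq> left_ann x"
proof -
  have "x * 1 \<in> right_princ x" unfolding right_princ_def by blast
  with assms obtain u where "x = a * u" by (auto simp: right_princ_def)
  then show ?thesis by (auto simp: left_ann_def simp flip: mult.assoc)
qed

lemma right_ann_mono: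
  fixes a x :: "'a::{ring, monoid_mult}"
  assumes "left_princ x \<subseteq> left_princ a"
  shows "right_ann a \<subseteq> right_ann x"
proof -
  have "1 * x \<in> left_princ x" unfolding left_princ_def by blast
  with assms obtain u where "x = u * a" by (auto simp: left_princ_def)
  then show ?thesis by (auto simp: right_ann_def mult.assoc)
qed

text \<open>The first two defining equations swap and the third is symmetric. This lets one-sided
  inclusions be upgraded to equalities.\<close>

lemma is_group_inverse_sym: "is_group_inverse a x \<Longrightarrow> is_group_inverse x a"
  unfolding is_group_inverse_def by metis

text \<open>Commutation turns \<open>x = x * a * x\<close> into \<open>x = a * (x * x)\<close>, so
  \<open>x\<close> is a right multiple of \<open>a\<close>.\<close>

lemma is_group_inverse_right_princ_subset:
  fixes a x :: "'a::{ring, monoid_mult}"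
  assumes "is_group_inverse a x"
  shows "right_princ x \<subseteq> right_princ a"
proof -
  have e: "a * (x * x) = x" using assms unfolding is_group_inverse_def by (metis mult.assoc)
  have "x * y = a * (x * x * y)" for y by (simp only: e flip: mult.assoc [of a "x * x" y])
  then show ?thesis unfolding right_princ_def by blast
qed

lemma is_group_inverse_left_princ_subset:
  fixes a x :: "'a::{ring, monoid_mult}"
  assumes "is_group_inverse a x"
  shows "left_princ x \<subseteq> left_princ a"
proof -
  have e: "x * x * a = x" using assms unfolding is_group_inverse_def by (metis mult.assoc)
  have "y * x = y * (x * x) * a" for y by (simp only: e mult.assoc [of y "x * x" a])
  then show ?thesis unfolding left_princ_def by blast
qed

lemma is_group_inverse_if_ann_subset:
  fixes a x :: "'a::{ring, monoid_mult}"
  assumes axa: "a * x * a = a"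
    and l: "left_ann a \<subseteq> left_ann x" and r: "right_ann a \<subseteq> right_ann x"
  shows "is_group_inverse a x"
proof -
  have "1 - a * x \<in> left_ann a" using axa by (simp add: left_ann_def left_diff_distrib)
  with l have "1 - a * x \<in> left_ann x" by blast
  then have x1: "a * x * x = x" by (simp add: left_ann_def left_diff_distrib)
  have "1 - x * a \<in> right_ann a"
    using axa by (simp add: right_ann_def right_diff_distrib flip: mult.assoc)
  with r have "1 - x * a \<in> right_ann x" by blast
  then have x2: "x * x * a = x"
    by (simp add: right_ann_def right_diff_distrib flip: mult.assoc)
  have comm: "a * x = x * a" using x1 x2 by (metis mult.assoc)
  \<comment> \<open>Commutation rewrites \<open>a * x * x = x\<close> into the remaining defining
    equation.\<close>
  then have "x * a * x = x" using x1 by metis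
  with axa comm show ?thesis unfolding is_group_inverse_def by blast
qed

text \<open>By uniqueness the description operator returns any witness, so statement (i) becomes a
  single predicate free of \<open>THE\<close>.\<close>

lemma group_inverse_iff:
  "group_invertible a \<and> x = group_inverse a \<longleftrightarrow> is_group_inverse a x"
  by (metis group_invertible_def group_inverse_eqI)

theorem theorem2p7:
  fixes a x :: "'a::involutive_ring"
  shows
    "((group_invertible a \<and> x = group_inverse a) \<longleftrightarrow>
        (a * x * a = a \<and> right_princ x = right_princ a \<and> left_princ x = left_princ a)) \<and>
     ((group_invertible a \<and> x = group_inverse a) \<longleftrightarrow>
        (a * x * a = a \<and> left_ann x = left_ann a \<and> right_ann x = right_ann a)) \<and>
     ((group_invertible a \<and> x = group_inverse a) \<longleftrightarrow>
        (a * x * a = a \<and> right_princ x \<subseteq> right_princ a \<and> left_princ x \<subseteq> left_princ a)) \<and>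
     ((group_invertible a \<and> x = group_inverse a) \<longleftrightarrow>
        (a * x * a = a \<and> left_ann a \<subseteq> left_ann x \<and> right_ann a \<subseteq> right_ann x))"
proof -
  let ?i = "is_group_inverse a x"
  \<comment> \<open>The reverse inclusions come from exchanging the roles of \<open>a\<close> and
    \<open>x\<close>.\<close>
  have princ: "right_princ x = right_princ a" "left_princ x = left_princ a" if ?i
    using that is_group_inverse_sym [OF that]
    by (simp_all add: set_eq_subset
        is_group_inverse_right_princ_subset is_group_inverse_left_princ_subset)
  then have ann: "left_ann x = left_ann a" "right_ann x = right_ann a" if ?i
    using that by (simp_all add: set_eq_subset left_ann_mono right_ann_mono)
  have axa: "a * x * a = a" if ?i
    using that unfolding is_group_inverse_def by blast
  have inv: ?i if "a * x * a = a" "left_ann a \<subseteq> left_ann x" "right_ann a \<subseteq> right_ann x"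
    using that by (rule is_group_inverse_if_ann_subset)
  \<comment> \<open>Statement (iv) implies (v), since inclusions of principal ideals reverse to
    inclusions of annihilators.\<close>
  then have inv': ?i
    if "a * x * a = a" "right_princ x \<subseteq> right_princ a" "left_princ x \<subseteq> left_princ a"
    using that by (simp add: left_ann_mono right_ann_mono)
  \<comment> \<open>Statement (i) gives the equalities of (ii) and (iii), which contain the
    inclusions of (iv) and (v); each of these leads back to (i).\<close>
  show ?thesis
    unfolding group_inverse_iff using princ ann axa inv inv' by (intro conjI iffI) blast+
qed

end
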